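(* Let $E\neq\{0\}$ be a complex Hilbert space with open unit ball $B_E$. There exist a sequence $(z_n)\subset\mathbb{C}$, a point $x\in B_E$ and a sequence $(y_n)\subset B_E$ such that $z_nx,\,z_ny_n\in B_E$ for every $n$, with $z_n\neq 0$ and $y_n\neq x$, but the sequence $$\frac{\rho_E(z_nx,z_ny_n)}{|z_n|\,\rho_E(x,y_n)}$$ is unbounded.
   Context: For a complex Hilbert space $E$ with open unit ball $B_E$, the pseudohyperbolic distance $\rho_E(x,y)\in[0,1)$ of $x,y\in B_E$ is given by $$\rho_E(x,y)^2=1-\frac{(1-\|x\|^2)(1-\|y\|^2)}{|1-\langle x,y\rangle|^2}.$$ *)

theory Defs
  imports "HOL-Analysis.Analysis"
begin

text \<open>
  Complex inner product spaces, on top of the library's real normed vector spaces. The remaining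
  axioms of a complex vector space and of a (positive definite) inner product follow:
  \<open>1 *\<^sub>C x = x\<close> from \<open>scaleC_of_real\<close>, additivity and conjugate-linearity in the second argument
  from \<open>cinner_commute\<close>, definiteness from \<open>cinner_self\<close> and definiteness of the norm.
  The inner product is linear in its first argument.
\<close>

class complex_inner = real_normed_vector +
  fixes scaleC :: "complex \<Rightarrow> 'a \<Rightarrow> 'a"  (infixr \<open>*\<^sub>C\<close> 75)
    and cinner :: "'a \<Rightarrow> 'a \<Rightarrow> complex"
  assumes scaleC_add_right: "a *\<^sub>C (x + y) = a *\<^sub>C x + a *\<^sub>C y"
    and scaleC_add_left: "(a + b) *\<^sub>C x = a *\<^sub>C x + b *\<^sub>C x"
    and scaleC_scaleC: "a *\<^sub>C b *\<^sub>C x = (a * b) *\<^sub>C x"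
    and scaleC_of_real: "complex_of_real r *\<^sub>C x = r *\<^sub>R x"
    and cinner_commute: "cinner x y = cnj (cinner y x)"
    and cinner_add_left: "cinner (x + y) w = cinner x w + cinner y w"
    and cinner_scaleC_left: "cinner (a *\<^sub>C x) y = a * cinner x y"
    and cinner_self: "cinner x x = complex_of_real ((norm x)\<^sup>2)"

class complex_hilbert_space = complex_inner + complete_space

instantiation complex :: complex_hilbert_space
begin

definition scaleC_complex :: "complex \<Rightarrow> complex \<Rightarrow> complex"
  where "scaleC_complex a x = a * x"

definition cinner_complex :: "complex \<Rightarrow> complex \<Rightarrow> complex"
  where "cinner_complex x y = x * cnj y"

instance
  by standard
    (auto simp: scaleC_complex_def cinner_complex_def algebra_simps scaleR_conv_of_real
      complex_norm_square[symmetric])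

end

text \<open>The radicand is nonnegative, and at most 1, whenever \<open>x\<close> and \<open>y\<close> lie in the open unit ball;
  the definition is only meaningful there.\<close>

definition pseudohyperbolic_dist :: "'a::complex_inner \<Rightarrow> 'a \<Rightarrow> real"
  where "pseudohyperbolic_dist x y =
    sqrt (1 - (1 - (norm x)\<^sup>2) * (1 - (norm y)\<^sup>2) / (cmod (1 - cinner x y))\<^sup>2)"

end

theory Submission
  imports Defs
begin

text \<open>
  The quotient blows up because the scalars may have modulus larger than 1 and so push two points
  from well inside the ball towards its boundary. It is enough to look at real multiples \<open>a e\<close>, \<open>b e\<close> of one unit vector \<open>e\<close>, where
  \<open>pseudohyperbolic_dist\<close> is the classical \<open>\<bar>a - b\<bar> / \<bar>1 - a b\<bar>\<close>
  (\<open>pseudohyperbolic_dist_on_line\<close>). For real \<open>z > 0\<close> the factors \<open>\<bar>a - b\<bar>\<close> and \<open>z\<close> cancel, so that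
  the quotient is \<open>\<bar>1 - a b\<bar> / \<bar>1 - z\<^sup>2 a b\<bar>\<close>. If \<open>a = 1/2\<close> stays fixed, the numerator stays above
  \<open>1/2\<close>, while the denominator tends to \<open>0\<close> as soon as \<open>z a\<close> and \<open>z b\<close> both tend to \<open>1\<close>. The
  choice \<open>z a = t\<close>, \<open>z b = t\<^sup>2\<close> with \<open>t\<close> tending to \<open>1\<close> from below does this and keeps
  \<open>a \<noteq> b\<close>.
\<close>

lemma cinner_scaleR_unit:
  fixes e :: "'a::complex_inner"
  assumes "norm e = 1"
  shows "cinner (a *\<^sub>R e) (b *\<^sub>R e) = complex_of_real (a * b)"
proof -
  have left: "cinner (r *\<^sub>R v) w = complex_of_real r * cinner v w" for r and v w :: 'a
    by (metis scaleC_of_real cinner_scaleC_left)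
  have "cinner e (b *\<^sub>R e) = cnj (cinner (b *\<^sub>R e) e)"
    by (rule cinner_commute)
  also have "\<dots> = complex_of_real b"
    using assms by (simp add: left cinner_self)
  finally show ?thesis
    by (simp add: left)
qed

text \<open>The numerator of the radicand collapses because
  \<open>(1 - a b)\<^sup>2 - (1 - a\<^sup>2) (1 - b\<^sup>2) = (a - b)\<^sup>2\<close>.\<close>

lemma pseudohyperbolic_dist_on_line:
  fixes e :: "'a::complex_inner"
  assumes "norm e = 1" and "a * b \<noteq> 1"
  shows "pseudohyperbolic_dist (a *\<^sub>R e) (b *\<^sub>R e) = \<bar>a - b\<bar> / \<bar>1 - a * b\<bar>"
proof -
  have "1 - complex_of_real (a * b) = complex_of_real (1 - a * b)"
    by simp
  then have "cmod (1 - complex_of_real (a * b)) = \<bar>1 - a * b\<bar>"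
    by (metis norm_of_real real_norm_def)
  then have "pseudohyperbolic_dist (a *\<^sub>R e) (b *\<^sub>R e) =
      sqrt (1 - (1 - a\<^sup>2) * (1 - b\<^sup>2) / (1 - a * b)\<^sup>2)"
    unfolding pseudohyperbolic_dist_def cinner_scaleR_unit[OF assms(1)]
    using assms(1) by simp
  also have "1 - (1 - a\<^sup>2) * (1 - b\<^sup>2) / (1 - a * b)\<^sup>2 = ((a - b) / (1 - a * b))\<^sup>2"
  proof -
    have "(1 - a * b)\<^sup>2 \<noteq> 0"
      using assms(2) by simp
    then have "1 - (1 - a\<^sup>2) * (1 - b\<^sup>2) / (1 - a * b)\<^sup>2 =
        ((1 - a * b)\<^sup>2 - (1 - a\<^sup>2) * (1 - b\<^sup>2)) / (1 - a * b)\<^sup>2"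
      by (simp add: diff_divide_distrib)
    also have "(1 - a * b)\<^sup>2 - (1 - a\<^sup>2) * (1 - b\<^sup>2) = (a - b)\<^sup>2"
      by algebra
    finally show ?thesis
      by (simp add: power_divide)
  qed
  finally show ?thesis
    by simp
qed

text \<open>The pair \<open>e/2\<close>, \<open>t e/2\<close> is moved by the factor \<open>2 t\<close> to \<open>t e\<close>, \<open>t\<^sup>2 e\<close>. The exact quotient
  is \<open>(1 - t/4) / (1 - t\<^sup>3)\<close>, and \<open>1 - t\<^sup>3 \<le> 3 (1 - t)\<close>.\<close>

lemma dilation_quotient_lower_bound:
  fixes e :: "'a::complex_inner"
  assumes e: "norm e = 1" and t: "0 < t" "t < 1"
  shows "1 / (4 * (1 - t)) \<le>
    pseudohyperbolic_dist (t *\<^sub>R e) (t\<^sup>2 *\<^sub>R e) /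
      (2 * t * pseudohyperbolic_dist ((1/2) *\<^sub>R e) ((t/2) *\<^sub>R e))"
proof -
  have cube: "t ^ 3 < 1"
    using t power_strict_mono[of t 1 3] by simp
  have far: "pseudohyperbolic_dist (t *\<^sub>R e) (t\<^sup>2 *\<^sub>R e) = t * (1 - t) / (1 - t ^ 3)"
  proof -
    have prod: "t * t\<^sup>2 = t ^ 3" and diff: "t - t\<^sup>2 = t * (1 - t)"
      by algebra+
    have "0 \<le> t * (1 - t)"
      using t by simp
    then show ?thesis
      using pseudohyperbolic_dist_on_line[OF e, of t "t\<^sup>2"] cube
      unfolding prod diff by simp
  qed
  have near: "pseudohyperbolic_dist ((1/2) *\<^sub>R e) ((t/2) *\<^sub>R e) = (1 - t) / 2 / (1 - t / 4)"
  proof -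
    have diff: "\<bar>1/2 - t/2\<bar> = (1 - t) / 2" and prod: "1/2 * (t/2) = t/4"
      and pos: "\<bar>1 - t/4\<bar> = 1 - t/4" and neq: "t/4 \<noteq> 1"
      using t by (auto simp: field_simps)
    show ?thesis
      using pseudohyperbolic_dist_on_line[OF e, of "1/2" "t/2"] neq
      unfolding diff prod pos by blast
  qed
  have quotient: "t * (1 - t) / (1 - t ^ 3) / (2 * t * ((1 - t) / 2 / (1 - t / 4))) =
      (1 - t / 4) / (1 - t ^ 3)"
  proof -
    have "2 * t * (r / 2 / s) = t * r / s" for r s :: real
      by simp
    then have "2 * t * ((1 - t) / 2 / (1 - t / 4)) = t * (1 - t) / (1 - t / 4)" .
    moreover have "t * (1 - t) \<noteq> 0"
      using t by simp
    ultimately show ?thesis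
      by simp
  qed
  have "1 - t ^ 3 = (1 - t) * (1 + t + t\<^sup>2)"
    by algebra
  also have "\<dots> \<le> (1 - t) * 3"
    using t power_le_one[of t 2] by (intro mult_left_mono) auto
  finally have "3 / 4 / (3 * (1 - t)) \<le> (1 - t / 4) / (1 - t ^ 3)"
    using t cube by (intro frac_le) auto
  moreover have "3 / 4 / (3 * (1 - t)) = 1 / (4 * (1 - t))"
    using t by (simp add: field_simps)
  ultimately show ?thesis
    unfolding far near quotient by simp
qed

theorem proposition2p1:
  assumes "(UNIV :: 'a::complex_hilbert_space set) \<noteq> {0}"
  shows "\<exists>(z :: nat \<Rightarrow> complex) (x :: 'a) (y :: nat \<Rightarrow> 'a).
    x \<in> ball 0 1 \<and> (\<forall>n. y n \<in> ball 0 1) \<and>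
    (\<forall>n. z n *\<^sub>C x \<in> ball 0 1 \<and> z n *\<^sub>C y n \<in> ball 0 1 \<and> z n \<noteq> 0 \<and> y n \<noteq> x) \<and>
    \<not> bounded (range (\<lambda>n. pseudohyperbolic_dist (z n *\<^sub>C x) (z n *\<^sub>C y n) /
                           (cmod (z n) * pseudohyperbolic_dist x (y n))))"
proof -
  obtain v :: 'a where "v \<noteq> 0"
    using assms by auto
  define e where "e = sgn v"
  have e: "norm e = 1"
    using \<open>v \<noteq> 0\<close> by (simp add: e_def norm_sgn)
  define t :: "nat \<Rightarrow> real" where "t n = 1 - 1 / (real n + 2)" for n
  have t: "0 < t n" "t n < 1" for n
    by (auto simp: t_def field_simps)
  define z where "z n = complex_of_real (2 * t n)" for n
  define x where "x = (1/2) *\<^sub>R e"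
  define y where "y n = (t n / 2) *\<^sub>R e" for n
  have zx: "z n *\<^sub>C x = t n *\<^sub>R e" for n
    unfolding z_def x_def scaleC_of_real by simp
  have zy: "z n *\<^sub>C y n = (t n)\<^sup>2 *\<^sub>R e" for n
    unfolding z_def y_def scaleC_of_real by (simp add: power2_eq_square)
  have x_ball: "x \<in> ball 0 1"
    using e by (simp add: x_def)
  have y_ball: "y n \<in> ball 0 1" for n
    using e t[of n] by (simp add: y_def)
  have zx_ball: "z n *\<^sub>C x \<in> ball 0 1" for n
    using e t[of n] by (simp add: zx)
  have zy_ball: "z n *\<^sub>C y n \<in> ball 0 1" for n
    using e t[of n] by (simp add: zy power_Suc_less_one abs_square_less_1)
  have z_nonzero: "z n \<noteq> 0" for n
    using t(1)[of n] by (simp add: z_def)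
  have y_neq_x: "y n \<noteq> x" for n
    using e t(2)[of n] by (auto simp: y_def x_def)
  let ?q = "\<lambda>n. pseudohyperbolic_dist (z n *\<^sub>C x) (z n *\<^sub>C y n) /
                 (cmod (z n) * pseudohyperbolic_dist x (y n))"
  have lower: "(real n + 2) / 4 \<le> ?q n" for n
  proof -
    have "cmod (z n) = 2 * t n"
      using t(1)[of n] by (simp add: z_def norm_mult)
    moreover have "1 / (4 * (1 - t n)) = (real n + 2) / 4"
      by (simp add: t_def)
    ultimately show ?thesis
      using dilation_quotient_lower_bound[OF e t, of n]
      unfolding zx zy unfolding x_def y_def by metis
  qed
  have "\<not> bounded (range ?q)"
  proof
    assume "bounded (range ?q)"
    then obtain B where B: "\<bar>?q n\<bar> \<le> B" for n
      by (auto simp: bounded_iff)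
    obtain n :: nat where "4 * B < real n"
      using reals_Archimedean2 by blast
    then have "B < (real n + 2) / 4"
      by simp
    with lower[of n] B[of n] show False
      by linarith
  qed
  then show ?thesis
    using x_ball y_ball zx_ball zy_ball z_nonzero y_neq_x by blast
qed

end
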